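(* Let $\gamma(s)$ be a partially null curve in $E_1^4$ with Frenet vector fields $F_1,\dots,F_4$ and let $r>0$ be constant. The tubular hypersurfaces $$T_1=\gamma\mp r\left(\sin f\,F_2+g\cos f\,F_3+\tfrac{\cos f}{2g}F_4\right),\quad T_2=\gamma\mp r\left(\cos f\,F_2+g\sin f\,F_3+\tfrac{\sin f}{2g}F_4\right),$$ $$T_3=\gamma\mp r\left(\cosh f\,F_2+g\sinh f\,F_3-\tfrac{\sinh f}{2g}F_4\right),\quad T_4=\gamma\mp r\left(\sinh f\,F_2+g\cosh f\,F_3-\tfrac{\cosh f}{2g}F_4\right)$$ are $(H_{T_i},K_{T_i})_{st}$-Weingarten, $(H_{T_i},K_{T_i})_{sw}$-Weingarten and $(H_{T_i},K_{T_i})_{tw}$-Weingarten for each $i\in\{1,2,3,4\}$, where $K_{T_i}$ and $H_{T_i}$ are the Gaussian and mean curvatures of $T_i$.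
   Context: $E_1^4$ is $\mathbb{R}^4$ with $\langle u,v\rangle=-u_1v_1+u_2v_2+u_3v_3+u_4v_4$. A partially null curve is a unit speed spacelike curve $\gamma(s)$ whose binormal is null; it has a Frenet frame $F_1=\gamma',F_2,F_3,F_4$ with $\langle F_1,F_1\rangle=\langle F_2,F_2\rangle=\langle F_3,F_4\rangle=1$, all other products $\langle F_i,F_j\rangle$ zero, and $F_1'=k_1F_2$, $F_2'=-k_1F_1+k_2F_3$, $F_3'=k_3F_3$, $F_4'=-k_2F_2-k_3F_4$, where $k_3=0$ for all $s$. $f=f(t,w)$ and $g=g(t,w)$ are smooth real functions with $g$ nowhere zero; $\mp$ means either sign may be chosen. For a hypersurface $\Omega(u_1,u_2,u_3)$ in $E_1^4$ with unit normal $N$, $\varepsilon=\langle N,N\rangle=\pm1$, put $g_{ij}=\langle\Omega_{u_i},\Omega_{u_j}\rangle$, $h_{ij}=\langle\Omega_{u_iu_j},N\rangle$, $S=[g_{ij}]^{-1}[h_{ij}]$; then $K=\varepsilon\det[h_{ij}]/\det[g_{ij}]$ and $3\varepsilon H=\operatorname{tr}S$ (at points where $\det[g_{ij}]\ne0$). For parameters $x,y\in\{s,t,w\}$, a hypersurface with Gaussian curvature $K$ and mean curvature $H$ is $(H,K)_{xy}$-Weingarten if $H_xK_y-H_yK_x=0$, subscripts denoting partial derivatives. *)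

theory Defs
  imports "HOL-Analysis.Analysis"
begin

text \<open>Minkowski space-time: the first coordinate is timelike.\<close>

definition lorentz :: "real^4 \<Rightarrow> real^4 \<Rightarrow> real" where
  "lorentz u v = - (u$1 * v$1) + u$2 * v$2 + u$3 * v$3 + u$4 * v$4"

text \<open>Meant for open \<open>S\<close>: all partial derivatives of all orders exist and are continuous.\<close>

primrec Ck_on :: "nat \<Rightarrow> 'a::euclidean_space set \<Rightarrow> ('a \<Rightarrow> 'b::real_normed_vector) \<Rightarrow> bool" where
  "Ck_on 0 S f \<longleftrightarrow> continuous_on S f"
| "Ck_on (Suc k) S f \<longleftrightarrow> (\<forall>x\<in>S. f differentiable (at x)) \<and>
     (\<forall>b\<in>Basis. Ck_on k S (\<lambda>x. frechet_derivative f (at x) b))"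

definition smooth_on :: "'a::euclidean_space set \<Rightarrow> ('a \<Rightarrow> 'b::real_normed_vector) \<Rightarrow> bool" where
  "smooth_on S f \<longleftrightarrow> (\<forall>k. Ck_on k S f)"

definition partially_null_curve ::
  "real set \<Rightarrow> (real \<Rightarrow> real^4) \<Rightarrow> (real \<Rightarrow> real^4) \<Rightarrow> (real \<Rightarrow> real^4) \<Rightarrow> (real \<Rightarrow> real^4)
    \<Rightarrow> (real \<Rightarrow> real^4) \<Rightarrow> (real \<Rightarrow> real) \<Rightarrow> (real \<Rightarrow> real) \<Rightarrow> (real \<Rightarrow> real) \<Rightarrow> bool" where
  "partially_null_curve I \<gamma> F1 F2 F3 F4 k1 k2 k3 \<longleftrightarrow>
     open I \<and> is_interval I \<and>
     smooth_on I \<gamma> \<and> smooth_on I F1 \<and> smooth_on I F2 \<and> smooth_on I F3 \<and> smooth_on I F4 \<and>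
     (\<forall>s\<in>I.
        lorentz (F1 s) (F1 s) = 1 \<and> lorentz (F2 s) (F2 s) = 1 \<and> lorentz (F3 s) (F4 s) = 1 \<and>
        lorentz (F3 s) (F3 s) = 0 \<and> lorentz (F4 s) (F4 s) = 0 \<and>
        lorentz (F1 s) (F2 s) = 0 \<and> lorentz (F1 s) (F3 s) = 0 \<and> lorentz (F1 s) (F4 s) = 0 \<and>
        lorentz (F2 s) (F3 s) = 0 \<and> lorentz (F2 s) (F4 s) = 0 \<and>
        (\<gamma> has_vector_derivative F1 s) (at s) \<and>
        (F1 has_vector_derivative k1 s *\<^sub>R F2 s) (at s) \<and>
        (F2 has_vector_derivative - k1 s *\<^sub>R F1 s + k2 s *\<^sub>R F3 s) (at s) \<and>
        (F3 has_vector_derivative k3 s *\<^sub>R F3 s) (at s) \<and>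
        (F4 has_vector_derivative - k2 s *\<^sub>R F2 s - k3 s *\<^sub>R F4 s) (at s) \<and>
        k3 s = 0)"

text \<open>A point \<open>p :: real^3\<close> collects the parameters, \<open>p$1 = u\<^sub>1\<close>, \<open>p$2 = u\<^sub>2\<close>, \<open>p$3 = u\<^sub>3\<close>;
  for the tubular hypersurfaces these are \<open>s\<close>, \<open>t\<close>, \<open>w\<close>.\<close>

definition partial :: "3 \<Rightarrow> (real^3 \<Rightarrow> 'a::real_normed_vector) \<Rightarrow> real^3 \<Rightarrow> 'a" where
  "partial i F p = vector_derivative (\<lambda>h. F (p + h *\<^sub>R axis i 1)) (at 0)"

definition has_partial :: "3 \<Rightarrow> (real^3 \<Rightarrow> 'a::real_normed_vector) \<Rightarrow> real^3 \<Rightarrow> bool" where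
  "has_partial i F p \<longleftrightarrow> (\<lambda>h. F (p + h *\<^sub>R axis i 1)) differentiable (at 0)"

definition first_form :: "(real^3 \<Rightarrow> real^4) \<Rightarrow> real^3 \<Rightarrow> real^3^3" where
  "first_form \<Omega> p = (\<chi> i j. lorentz (partial i \<Omega> p) (partial j \<Omega> p))"

definition second_form :: "(real^3 \<Rightarrow> real^4) \<Rightarrow> (real^3 \<Rightarrow> real^4) \<Rightarrow> real^3 \<Rightarrow> real^3^3" where
  "second_form \<Omega> N p = (\<chi> i j. lorentz (partial j (partial i \<Omega>) p) (N p))"

definition shape_operator :: "(real^3 \<Rightarrow> real^4) \<Rightarrow> (real^3 \<Rightarrow> real^4) \<Rightarrow> real^3 \<Rightarrow> real^3^3" where
  "shape_operator \<Omega> N p = matrix_inv (first_form \<Omega> p) ** second_form \<Omega> N p"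

text \<open>The points of the parameter domain \<open>M\<close> at which the curvatures are defined.\<close>

definition regular_points :: "(real^3) set \<Rightarrow> (real^3 \<Rightarrow> real^4) \<Rightarrow> (real^3) set" where
  "regular_points M \<Omega> = {p\<in>M. det (first_form \<Omega> p) \<noteq> 0}"

text \<open>Continuity only excludes arbitrary jumps between \<open>N\<close> and \<open>-N\<close>; where the first fundamental
  form is nondegenerate, a continuous unit normal field of a smooth hypersurface is smooth.\<close>

definition unit_normal_on :: "(real^3) set \<Rightarrow> (real^3 \<Rightarrow> real^4) \<Rightarrow> (real^3 \<Rightarrow> real^4) \<Rightarrow> bool" where
  "unit_normal_on U \<Omega> N \<longleftrightarrow> continuous_on U N \<and>
     (\<forall>p\<in>U. (\<forall>i. lorentz (N p) (partial i \<Omega> p) = 0) \<and>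
            (lorentz (N p) (N p) = 1 \<or> lorentz (N p) (N p) = -1))"

definition gauss_curvature :: "(real^3 \<Rightarrow> real^4) \<Rightarrow> (real^3 \<Rightarrow> real^4) \<Rightarrow> real^3 \<Rightarrow> real" where
  "gauss_curvature \<Omega> N p =
     lorentz (N p) (N p) * det (second_form \<Omega> N p) / det (first_form \<Omega> p)"

definition mean_curvature :: "(real^3 \<Rightarrow> real^4) \<Rightarrow> (real^3 \<Rightarrow> real^4) \<Rightarrow> real^3 \<Rightarrow> real" where
  "mean_curvature \<Omega> N p = trace (shape_operator \<Omega> N p) / (3 * lorentz (N p) (N p))"

text \<open>Existence of the partial derivatives is part of the condition, since \<open>partial\<close> is an
  unspecified value where the derivative does not exist.\<close>

definition weingarten_on ::
  "3 \<Rightarrow> 3 \<Rightarrow> (real^3) set \<Rightarrow> (real^3 \<Rightarrow> real^4) \<Rightarrow> (real^3 \<Rightarrow> real^4) \<Rightarrow> bool" where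
  "weingarten_on x y U \<Omega> N \<longleftrightarrow>
     (let H = mean_curvature \<Omega> N; K = gauss_curvature \<Omega> N in
      \<forall>p\<in>U. has_partial x H p \<and> has_partial y H p \<and> has_partial x K p \<and> has_partial y K p \<and>
        partial x H p * partial y K p - partial y H p * partial x K p = 0)"

text \<open>The four tubular hypersurfaces; \<open>\<sigma> = 1\<close> or \<open>\<sigma> = -1\<close> is the sign chosen for \<open>\<mp>\<close>.\<close>

definition tube1 ::
  "real \<Rightarrow> real \<Rightarrow> (real \<Rightarrow> real^4) \<Rightarrow> (real \<Rightarrow> real^4) \<Rightarrow> (real \<Rightarrow> real^4) \<Rightarrow> (real \<Rightarrow> real^4)
    \<Rightarrow> (real \<Rightarrow> real \<Rightarrow> real) \<Rightarrow> (real \<Rightarrow> real \<Rightarrow> real) \<Rightarrow> real^3 \<Rightarrow> real^4" where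
  "tube1 \<sigma> r \<gamma> F2 F3 F4 f g = (\<lambda>p. let s = p$1; \<phi> = f (p$2) (p$3); \<psi> = g (p$2) (p$3) in
     \<gamma> s + (\<sigma> * r) *\<^sub>R
       (sin \<phi> *\<^sub>R F2 s + (\<psi> * cos \<phi>) *\<^sub>R F3 s + (cos \<phi> / (2 * \<psi>)) *\<^sub>R F4 s))"

definition tube2 ::
  "real \<Rightarrow> real \<Rightarrow> (real \<Rightarrow> real^4) \<Rightarrow> (real \<Rightarrow> real^4) \<Rightarrow> (real \<Rightarrow> real^4) \<Rightarrow> (real \<Rightarrow> real^4)
    \<Rightarrow> (real \<Rightarrow> real \<Rightarrow> real) \<Rightarrow> (real \<Rightarrow> real \<Rightarrow> real) \<Rightarrow> real^3 \<Rightarrow> real^4" where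
  "tube2 \<sigma> r \<gamma> F2 F3 F4 f g = (\<lambda>p. let s = p$1; \<phi> = f (p$2) (p$3); \<psi> = g (p$2) (p$3) in
     \<gamma> s + (\<sigma> * r) *\<^sub>R
       (cos \<phi> *\<^sub>R F2 s + (\<psi> * sin \<phi>) *\<^sub>R F3 s + (sin \<phi> / (2 * \<psi>)) *\<^sub>R F4 s))"

definition tube3 ::
  "real \<Rightarrow> real \<Rightarrow> (real \<Rightarrow> real^4) \<Rightarrow> (real \<Rightarrow> real^4) \<Rightarrow> (real \<Rightarrow> real^4) \<Rightarrow> (real \<Rightarrow> real^4)
    \<Rightarrow> (real \<Rightarrow> real \<Rightarrow> real) \<Rightarrow> (real \<Rightarrow> real \<Rightarrow> real) \<Rightarrow> real^3 \<Rightarrow> real^4" where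
  "tube3 \<sigma> r \<gamma> F2 F3 F4 f g = (\<lambda>p. let s = p$1; \<phi> = f (p$2) (p$3); \<psi> = g (p$2) (p$3) in
     \<gamma> s + (\<sigma> * r) *\<^sub>R
       (cosh \<phi> *\<^sub>R F2 s + (\<psi> * sinh \<phi>) *\<^sub>R F3 s - (sinh \<phi> / (2 * \<psi>)) *\<^sub>R F4 s))"

definition tube4 ::
  "real \<Rightarrow> real \<Rightarrow> (real \<Rightarrow> real^4) \<Rightarrow> (real \<Rightarrow> real^4) \<Rightarrow> (real \<Rightarrow> real^4) \<Rightarrow> (real \<Rightarrow> real^4)
    \<Rightarrow> (real \<Rightarrow> real \<Rightarrow> real) \<Rightarrow> (real \<Rightarrow> real \<Rightarrow> real) \<Rightarrow> real^3 \<Rightarrow> real^4" where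
  "tube4 \<sigma> r \<gamma> F2 F3 F4 f g = (\<lambda>p. let s = p$1; \<phi> = f (p$2) (p$3); \<psi> = g (p$2) (p$3) in
     \<gamma> s + (\<sigma> * r) *\<^sub>R
       (sinh \<phi> *\<^sub>R F2 s + (\<psi> * cosh \<phi>) *\<^sub>R F3 s - (cosh \<phi> / (2 * \<psi>)) *\<^sub>R F4 s))"

end

theory Submission
  imports Defs
begin

text \<open>
  All four hypersurfaces have the form \<open>T = \<gamma>(s) + \<rho> V(s,t,w)\<close> with \<open>\<rho> = \<plusminus>r\<close>, where \<open>V\<close> is orthogonal to
  the unit tangent \<open>\<gamma>' = F\<^sub>1\<close> and \<open>\<langle>V, V\<rangle> = \<delta>\<close> is constantly \<open>1\<close> (for \<open>T\<^sub>1\<close>, \<open>T\<^sub>2\<close>,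
  \<open>T\<^sub>3\<close>) or \<open>-1\<close> (for \<open>T\<^sub>4\<close>). Every hypersurface of this form has the Weingarten property.

  Differentiating \<open>\<langle>V, V\<rangle> = \<delta>\<close> and \<open>\<langle>V, \<gamma>'\<rangle> = 0\<close> shows that \<open>V\<close> is normal to \<open>T\<close> and that \<open>\<gamma>'\<close> is
  orthogonal to \<open>T\<^sub>t\<close> and \<open>T\<^sub>w\<close>. At a regular point the normal line is unique, so \<open>N = \<eta> V\<close> with a sign
  \<open>\<eta>\<close>, which is locally constant by continuity. Put \<open>m = \<langle>\<gamma>', T\<^sub>s\<rangle>\<close> and let \<open>E\<close> be the matrix whose
  only nonzero entry is a \<open>1\<close> in the top left corner. Since \<open>\<rho> V = T - \<gamma>\<close>, differentiating
  \<open>\<langle>T\<^sub>i, V\<rangle> = 0\<close> gives \<open>[h\<^sub>i\<^sub>j] = \<kappa> ([g\<^sub>i\<^sub>j] - m E)\<close> with \<open>\<kappa> = - \<eta> / \<rho>\<close>.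
  Splitting \<open>T\<^sub>s\<close> into \<open>m \<gamma>'\<close> and a rest orthogonal to \<open>\<gamma>'\<close> leaves \<open>rest\<close>, \<open>T\<^sub>t\<close>, \<open>T\<^sub>w\<close> in the plane
  orthogonal to \<open>\<gamma>'\<close> and \<open>V\<close>; hence they are dependent and
  \<open>det [g\<^sub>i\<^sub>j] = m\<^sup>2 (g\<^sub>2\<^sub>2 g\<^sub>3\<^sub>3 - g\<^sub>2\<^sub>3 g\<^sub>3\<^sub>2)\<close>, that is, the top left entry of \<open>[g\<^sub>i\<^sub>j]\<^sup>-\<^sup>1\<close> is
  \<open>1 / m\<^sup>2\<close>. So \<open>K = \<delta> \<kappa>\<^sup>3 (1 - 1/m)\<close> and \<open>3 \<delta> H = \<kappa> (3 - 1/m)\<close>: the shape operator has the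
  eigenvalues \<open>\<kappa>\<close>, \<open>\<kappa>\<close>, \<open>\<kappa> (1 - 1/m)\<close>. Both curvatures are locally affine functions of the single
  function \<open>1/m\<close>, so their gradients are parallel and every Jacobian \<open>H\<^sub>x K\<^sub>y - H\<^sub>y K\<^sub>x\<close> vanishes.

  The carrying lemmas are \<open>normal_unique\<close>, \<open>det_gram_split\<close>, \<open>perturbed_form_invariants\<close> and, in the
  locale \<open>canal\<close>, \<open>second_form_V\<close> and \<open>curvatures\<close>. The closure properties of smooth maps serve to
  show that \<open>T\<close> and \<open>V\<close> are smooth, which yields all partial derivatives that occur.
\<close>

section \<open>Closure properties of smooth maps\<close>

lemma Ck_on_cong:
  assumes "open S" "\<And>x. x \<in> S \<Longrightarrow> f x = g x" "Ck_on k S f"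
  shows "Ck_on k S g"
  using assms(2,3)
proof (induction k arbitrary: f g)
  case 0
  then show ?case using continuous_on_cong[of S S f g] by simp
next
  case (Suc k)
  have "(g has_derivative frechet_derivative f (at x)) (at x)" if "x \<in> S" for x
    using Suc.prems that assms(1)
      has_derivative_transform_within_open[of f _ x UNIV S g]
    by (auto simp: frechet_derivative_works)
  then have "g differentiable (at x)" "frechet_derivative g (at x) = frechet_derivative f (at x)"
    if "x \<in> S" for x
    using that frechet_derivative_at[of g "frechet_derivative f (at x)" x]
    by (auto simp: differentiable_def)
  then show ?case
    using Suc.prems Suc.IH[of "\<lambda>x. frechet_derivative f (at x) b" for b] by auto
qed

text \<open>The total derivative in \<open>Ck_on\<close> is a choice term; any derivative that is known explicitly may
  replace it.\<close>

lemma Ck_on_SucI: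
  assumes "open S" "\<And>x. x \<in> S \<Longrightarrow> (f has_derivative f' x) (at x)"
    and "\<And>b. b \<in> Basis \<Longrightarrow> Ck_on k S (\<lambda>x. f' x b)"
  shows "Ck_on (Suc k) S f"
proof -
  have "f' x = frechet_derivative f (at x)" if "x \<in> S" for x
    using frechet_derivative_at[OF assms(2)[OF that]] .
  then have "Ck_on k S (\<lambda>x. frechet_derivative f (at x) b)" if "b \<in> Basis" for b
    using Ck_on_cong[OF assms(1) _ assms(3)[OF that]] by simp
  then show ?thesis using assms(2) by (auto simp: differentiable_def)
qed

lemma Ck_on_has_derivative:
  "Ck_on (Suc k) S f \<Longrightarrow> x \<in> S \<Longrightarrow> (f has_derivative frechet_derivative f (at x)) (at x)"
  by (auto simp: frechet_derivative_works)

lemma Ck_on_imp_continuous_on: "Ck_on k S f \<Longrightarrow> continuous_on S f"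
  by (cases k) (auto intro!: differentiable_imp_continuous_on differentiable_at_imp_differentiable_on)

lemma Ck_on_SucD: "Ck_on (Suc k) S f \<Longrightarrow> Ck_on k S f"
proof (induction k arbitrary: f)
  case 0
  then show ?case using Ck_on_imp_continuous_on[of "Suc 0"] by simp
next
  case (Suc k)
  then show ?case by (metis Ck_on.simps(2))
qed

lemma Ck_on_subset: "Ck_on k S f \<Longrightarrow> R \<subseteq> S \<Longrightarrow> Ck_on k R f"
  by (induction k arbitrary: f) (auto intro: continuous_on_subset)

lemma Ck_on_const: "open S \<Longrightarrow> Ck_on k S (\<lambda>x. c)"
  by (induction k arbitrary: c) (auto intro!: Ck_on_SucI continuous_intros derivative_eq_intros)

lemma Ck_on_add:
  assumes "open S" "Ck_on k S f" "Ck_on k S g"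
  shows "Ck_on k S (\<lambda>x. f x + g x)"
  using assms(2,3)
proof (induction k arbitrary: f g)
  case (Suc k)
  show ?case
    by (rule Ck_on_SucI[OF assms(1) has_derivative_add[OF Ck_on_has_derivative Ck_on_has_derivative]])
      (use Suc in auto)
qed (auto intro: continuous_intros)

text \<open>The product rule for every bounded bilinear operation at once: it is used for products of
  functions, scalar multiples of vector fields and constant factors.\<close>

lemma Ck_on_bilinear:
  assumes B: "bounded_bilinear B" and S: "open S" and "Ck_on k S f" "Ck_on k S g"
  shows "Ck_on k S (\<lambda>x. B (f x) (g x))"
  using assms(3,4)
proof (induction k arbitrary: f g)
  case 0
  then show ?case using bounded_bilinear.continuous_on[OF B] by auto
next
  case (Suc k)
  show ?case
    by (rule Ck_on_SucI[OF S bounded_bilinear.FDERIV[OF B Ck_on_has_derivative Ck_on_has_derivative]])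
      (use Suc in \<open>auto intro!: Ck_on_add[OF S] Suc.IH Ck_on_SucD[of k S f] Ck_on_SucD[of k S g]\<close>)
qed

text \<open>The outer function comes with the whole sequence of its derivatives, so that the induction on
  the order can pass from \<open>\<phi> n\<close> to \<open>\<phi> (Suc n)\<close>.\<close>

lemma Ck_on_compose_real:
  fixes \<phi> :: "nat \<Rightarrow> real \<Rightarrow> real"
  assumes S: "open S" and "Ck_on k S f"
    and "\<And>n y. (\<phi> n has_real_derivative \<phi> (Suc n) y) (at y)"
  shows "Ck_on k S (\<lambda>x. \<phi> n (f x))"
  using assms(2)
proof (induction k arbitrary: n)
  case 0
  have "continuous_on UNIV (\<phi> n)"
    using assms(3) by (meson DERIV_isCont continuous_at_imp_continuous_on)
  from continuous_on_compose2[OF this] 0 show ?case by simp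
next
  case (Suc k)
  have "((\<lambda>x. \<phi> n (f x)) has_derivative (\<lambda>h. \<phi> (Suc n) (f x) * frechet_derivative f (at x) h)) (at x)"
    if "x \<in> S" for x
    using has_derivative_compose[OF Ck_on_has_derivative[OF Suc.prems that]
        assms(3)[unfolded has_field_derivative_def]] .
  then show ?case
    by (rule Ck_on_SucI[OF S])
      (use Suc.prems Suc.IH[OF Ck_on_SucD[OF Suc.prems]] in
        \<open>auto intro!: Ck_on_bilinear[OF bounded_bilinear_mult S]\<close>)
qed

text \<open>The reciprocal reappears in its own derivative, so the induction feeds on itself and works on a
  domain where \<open>g\<close> has no zero.\<close>

lemma Ck_on_inverse:
  fixes g :: "'a::euclidean_space \<Rightarrow> real"
  assumes S: "open S" and "Ck_on k S g" and nz: "\<And>x. x \<in> S \<Longrightarrow> g x \<noteq> 0"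
  shows "Ck_on k S (\<lambda>x. inverse (g x))"
  using assms(2)
proof (induction k)
  case 0
  then show ?case using nz by (auto intro!: continuous_intros)
next
  case (Suc k)
  have "((\<lambda>x. inverse (g x)) has_derivative
      (\<lambda>h. (- 1) * (inverse (g x) * inverse (g x) * frechet_derivative g (at x) h))) (at x)"
    if "x \<in> S" for x
    using Ck_on_has_derivative[OF Suc.prems that] nz[OF that]
    by (auto intro!: derivative_eq_intros)
  moreover have "Ck_on k S (\<lambda>x. (- 1) * (inverse (g x) * inverse (g x) * frechet_derivative g (at x) b))"
    if "b \<in> Basis" for b
    using Suc.prems Suc.IH[OF Ck_on_SucD[OF Suc.prems]] that
    by (intro Ck_on_bilinear[OF bounded_bilinear_mult S] Ck_on_const[OF S]) auto
  ultimately show ?case by (rule Ck_on_SucI[OF S])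
qed

lemma Ck_on_sum:
  assumes "open S" "\<And>i. i \<in> A \<Longrightarrow> Ck_on k S (f i)"
  shows "Ck_on k S (\<lambda>x. \<Sum>i\<in>A. f i x)"
  using assms(2)
  by (induction A rule: infinite_finite_induct) (auto intro!: Ck_on_const Ck_on_add assms(1))

text \<open>The image of a basis vector under \<open>L\<close> need not be a basis vector, so the derivative is expanded
  into a combination of the basis derivatives of \<open>f\<close> with constant coefficients.\<close>

lemma Ck_on_compose_linear:
  fixes L :: "'a::euclidean_space \<Rightarrow> 'b::euclidean_space"
  assumes L: "bounded_linear L" and S: "open S" and "Ck_on k S f"
  shows "Ck_on k (L -` S) (\<lambda>x. f (L x))"
  using assms(3)
proof (induction k arbitrary: f)
  case 0
  then show ?case
    using continuous_on_compose2[of S f "L -` S" L] bounded_linear.linear[OF L]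
    by (auto intro: linear_continuous_on L)
next
  case (Suc k)
  have oS: "open (L -` S)"
    using S L by (simp add: continuous_open_vimage linear_continuous_at)
  have "((\<lambda>x. f (L x)) has_derivative
      (\<lambda>h. \<Sum>e\<in>Basis. (L h \<bullet> e) *\<^sub>R frechet_derivative f (at (L x)) e)) (at x)"
    if "x \<in> L -` S" for x
  proof -
    have d: "(f has_derivative frechet_derivative f (at (L x))) (at (L x))"
      using Ck_on_has_derivative[OF Suc.prems] that by auto
    note lin = has_derivative_linear[OF d]
    have *: "frechet_derivative f (at (L x)) y = (\<Sum>e\<in>Basis. (y \<bullet> e) *\<^sub>R frechet_derivative f (at (L x)) e)" for y
      using linear_sum[OF lin, of "\<lambda>e. (y \<bullet> e) *\<^sub>R e" Basis]
      by (simp only: euclidean_representation linear_scale[OF lin])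
    show ?thesis
      using has_derivative_compose[OF bounded_linear_imp_has_derivative[OF L] d]
      by (simp only: * [of "L _", symmetric])
  qed
  then show ?case
    by (rule Ck_on_SucI[OF oS])
      (use Suc in \<open>auto intro!: Ck_on_sum[OF oS] Ck_on_bilinear[OF bounded_bilinear_scaleR oS] Ck_on_const[OF oS]\<close>)
qed

lemma smooth_on_has_derivative:
  "smooth_on S f \<Longrightarrow> x \<in> S \<Longrightarrow> (f has_derivative frechet_derivative f (at x)) (at x)"
  unfolding smooth_on_def by (blast intro: Ck_on_has_derivative)

lemma smooth_on_imp_continuous_on: "smooth_on S f \<Longrightarrow> continuous_on S f"
  unfolding smooth_on_def by (blast intro: Ck_on_imp_continuous_on)

lemma smooth_on_compose_linear:
  fixes L :: "'a::euclidean_space \<Rightarrow> 'b::euclidean_space"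
  assumes "bounded_linear L" "open S" "R \<subseteq> L -` S" "smooth_on S f"
  shows "smooth_on R (\<lambda>x. f (L x))"
  using assms Ck_on_subset[OF Ck_on_compose_linear[OF assms(1,2)] assms(3)]
  unfolding smooth_on_def by blast

lemma smooth_on_mult:
  fixes f g :: "'a::euclidean_space \<Rightarrow> real"
  assumes "open S" "smooth_on S f" "smooth_on S g"
  shows "smooth_on S (\<lambda>x. f x * g x)"
  using assms unfolding smooth_on_def by (blast intro: Ck_on_bilinear bounded_bilinear_mult)

text \<open>The coefficient of \<open>F\<^sub>4\<close>, with the two signs that occur in the tubes.\<close>

lemma smooth_on_half_quotient:
  fixes f g :: "'a::euclidean_space \<Rightarrow> real"
  assumes "open S" "smooth_on S f" "smooth_on S g" "\<And>x. x \<in> S \<Longrightarrow> g x \<noteq> 0"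
  shows "smooth_on S (\<lambda>x. f x / (2 * g x))" "smooth_on S (\<lambda>x. - (f x / (2 * g x)))"
proof -
  have c: "smooth_on S (\<lambda>x. c * (f x * inverse (g x)))" for c
    using assms unfolding smooth_on_def
    by (intro allI Ck_on_bilinear[OF bounded_bilinear_mult] Ck_on_inverse Ck_on_const) auto
  show "smooth_on S (\<lambda>x. f x / (2 * g x))" "smooth_on S (\<lambda>x. - (f x / (2 * g x)))"
    using c[of "inverse 2"] c[of "- inverse 2"]
    by (simp_all only: divide_inverse inverse_mult_distrib mult_minus_left mult.left_commute[of "inverse 2"])
qed

lemma smooth_on_elementary:
  fixes f :: "'a::euclidean_space \<Rightarrow> real"
  assumes S: "open S" and f: "smooth_on S f"
  shows "smooth_on S (\<lambda>x. sin (f x))" "smooth_on S (\<lambda>x. cos (f x))"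
    and "smooth_on S (\<lambda>x. sinh (f x))" "smooth_on S (\<lambda>x. cosh (f x))"
proof -
  have Ck: "Ck_on k S f" for k using f by (simp add: smooth_on_def)
  \<comment> \<open>Differentiating sine is a shift by a quarter period, which also makes cosine a member of the
    sequence of derivatives.\<close>
  have "((\<lambda>y. sin (y + real n * (pi / 2))) has_real_derivative sin (y + real (Suc n) * (pi / 2))) (at y)" for n y
  proof -
    have "y + real (Suc n) * (pi / 2) = (y + real n * (pi / 2)) + pi / 2"
      by (simp add: algebra_simps)
    then have "sin (y + real (Suc n) * (pi / 2)) = cos (y + real n * (pi / 2))"
      by (simp only: sin_add sin_pi_half cos_pi_half mult_zero_right mult_1_right add_0)
    moreover have "((\<lambda>y. sin (y + c)) has_real_derivative cos (y + c)) (at y)" for c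
      by (auto intro!: derivative_eq_intros)
    ultimately show ?thesis by (simp only:)
  qed
  from Ck_on_compose_real[where \<phi>="\<lambda>n y. sin (y + real n * (pi / 2))", OF S Ck this]
  have trig: "smooth_on S (\<lambda>x. sin (f x + real n * (pi / 2)))" for n
    by (simp add: smooth_on_def)
  show "smooth_on S (\<lambda>x. sin (f x))" "smooth_on S (\<lambda>x. cos (f x))"
    using trig[of 0] trig[of 1] by (simp_all add: sin_add)
  have "((if even n then sinh else cosh) has_real_derivative (if even (Suc n) then sinh else cosh) y) (at y)"
    for n and y :: real
    by (auto intro!: derivative_eq_intros)
  from Ck_on_compose_real[where \<phi>="\<lambda>n. if even n then sinh else cosh", OF S Ck this]
  have hyp: "smooth_on S (\<lambda>x. (if even n then sinh else cosh) (f x))" for n :: nat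
    unfolding smooth_on_def by blast
  show "smooth_on S (\<lambda>x. sinh (f x))" "smooth_on S (\<lambda>x. cosh (f x))"
    using hyp[of 0] hyp[of 1] by simp_all
qed

section \<open>Lorentzian linear algebra\<close>

lemma bounded_bilinear_lorentz: "bounded_bilinear lorentz"
  unfolding bilinear_conv_bounded_bilinear[symmetric]
  by (auto simp: bilinear_def lorentz_def algebra_simps intro!: linearI)

interpretation lorentz: bounded_bilinear lorentz
  by (rule bounded_bilinear_lorentz)

lemma lorentz_commute: "lorentz u v = lorentz v u"
  by (simp add: lorentz_def)

lemma lorentz_nondegenerate:
  assumes "\<And>v. lorentz u v = 0"
  shows "u = 0"
  using assms[of "axis 1 1"] assms[of "axis 2 1"] assms[of "axis 3 1"] assms[of "axis 4 1"]
  by (simp add: lorentz_def vec_eq_iff forall_4 axis_def)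

definition gram :: "(3 \<Rightarrow> real^4) \<Rightarrow> real^3^3" where
  "gram X = (\<chi> i j. lorentz (X i) (X j))"

text \<open>If \<open>V\<close> is not null and the Gram matrix of the tangent vectors is invertible, then \<open>V\<close> and the
  tangent vectors form a basis, so a vector orthogonal to all of them vanishes. Applied to \<open>N\<close> minus
  its projection onto \<open>V\<close>, this gives the claim.\<close>

lemma normal_unique:
  assumes g: "det (gram X) \<noteq> 0" and V: "\<And>i. lorentz V (X i) = 0" "lorentz V V \<noteq> 0"
    and N: "\<And>i. lorentz N (X i) = 0"
  shows "N = (lorentz N V / lorentz V V) *\<^sub>R V"
proof -
  define x where "x = N - (lorentz N V / lorentz V V) *\<^sub>R V"
  have xX: "lorentz x (X i) = 0" for i
    by (simp add: x_def lorentz.diff_left lorentz.scaleR_left V N)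
  have xV: "lorentz x V = 0"
    using V by (simp add: x_def lorentz.diff_left lorentz.scaleR_left)
  define L where "L = (\<lambda>y::real^4. y$1 *\<^sub>R X 1 + y$2 *\<^sub>R X 2 + y$3 *\<^sub>R X 3 + y$4 *\<^sub>R V)"
  have lin: "linear L"
    by (auto simp: L_def algebra_simps intro!: linearI)
  \<comment> \<open>Pairing a linear relation with \<open>V\<close> kills its coefficient; pairing the rest with the \<open>X i\<close> gives
    a kernel vector of the Gram matrix.\<close>
  have "y = 0" if "L y = 0" for y
  proof -
    have "lorentz V (L y) = y$4 * lorentz V V"
      by (simp add: L_def lorentz.add_right lorentz.scaleR_right V)
    then have y4: "y$4 = 0" using that V by (simp add: lorentz.zero_right)
    define z :: "real^3" where "z = vector [y$1, y$2, y$3]"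
    have "(gram X *v z) $ i = lorentz (X i) (L y)" for i
      by (simp add: gram_def matrix_vector_mult_def sum_3 z_def L_def y4 lorentz.add_right lorentz.scaleR_right)
    then have "gram X *v z = 0" using that by (simp add: vec_eq_iff lorentz.zero_right)
    then have "z = 0" using g
      by (metis invertible_det_nz invertible_left_inverse matrix_left_invertible_ker)
    then have "y$1 = 0" "y$2 = 0" "y$3 = 0"
      by (simp_all add: z_def vec_eq_iff forall_3)
    then show "y = 0" using y4 by (simp add: vec_eq_iff forall_4)
  qed
  then have "surj L"
    using lin by (simp add: linear_injective_0 linear_injective_imp_surjective)
  moreover have "lorentz x (L y) = 0" for y
    by (simp add: L_def lorentz.add_right lorentz.scaleR_right xX xV)
  ultimately have "lorentz x v = 0" for v by (metis surjD)
  then have "x = 0" by (rule lorentz_nondegenerate)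
  then show ?thesis by (simp add: x_def)
qed

text \<open>Splitting \<open>X 1\<close> along \<open>e\<close> changes only the top left entry of the Gram matrix, by \<open>\<langle>e, X 1\<rangle>\<^sup>2\<close>. What
  remains are three vectors in the plane orthogonal to \<open>e\<close> and \<open>V\<close>, whose Gram determinant is \<open>0\<close>.\<close>

lemma det_gram_split:
  assumes e: "lorentz e e = 1" "lorentz e (X 2) = 0" "lorentz e (X 3) = 0"
    and V: "lorentz V e = 0" "\<And>i. lorentz V (X i) = 0" "lorentz V V \<noteq> 0"
  shows "det (gram X) = (lorentz e (X 1))\<^sup>2 * (gram X $ 2 $ 2 * gram X $ 3 $ 3 - gram X $ 2 $ 3 * gram X $ 3 $ 2)"
proof -
  define m where "m = lorentz e (X 1)"
  define Y where "Y = (\<lambda>i. if i = (1::3) then X 1 - m *\<^sub>R e else X i)"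
  have Y: "Y 1 = X 1 - m *\<^sub>R e" "Y 2 = X 2" "Y 3 = X 3" by (simp_all add: Y_def)
  have VY: "lorentz V (Y i) = 0" for i
    by (simp add: Y_def V lorentz.diff_right lorentz.scaleR_right)
  have eY: "lorentz e (Y i) = 0" for i
    using e exhaust_3[of i] by (auto simp: Y lorentz.diff_right lorentz.scaleR_right m_def)
  \<comment> \<open>Otherwise the orthogonal complement of the \<open>Y i\<close> would be the line through \<open>V\<close>; but it also
    contains \<open>e\<close>, a unit vector orthogonal to \<open>V\<close>.\<close>
  have "det (gram Y) = 0"
  proof (rule ccontr)
    assume "det (gram Y) \<noteq> 0"
    from normal_unique[OF this VY V(3) eY] have "e = 0"
      by (simp add: V lorentz_commute[of e V])
    then show False using e by (simp add: lorentz.zero_left)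
  qed
  moreover have ee: "lorentz (X i) e = lorentz e (X i)" for i by (rule lorentz_commute)
  have "gram Y $ 1 $ 1 = gram X $ 1 $ 1 - m\<^sup>2"
    by (simp add: gram_def Y lorentz.diff_right lorentz.diff_left lorentz.scaleR_right
        lorentz.scaleR_left ee e flip: m_def) (simp add: power2_eq_square)
  moreover have "gram Y $ i $ j = gram X $ i $ j" if "i \<noteq> 1 \<or> j \<noteq> 1" for i j
    using that exhaust_3[of i] exhaust_3[of j] e
    by (auto simp: gram_def Y lorentz.diff_right lorentz.diff_left lorentz.scaleR_right
        lorentz.scaleR_left ee)
  ultimately show ?thesis
    unfolding m_def[symmetric] by (simp add: det_3 algebra_simps)
qed

text \<open>The hypothesis on \<open>det G\<close> says that the top left entry of the inverse of \<open>G\<close> is \<open>1 / m\<^sup>2\<close>. A second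
  form that is a multiple of \<open>G\<close> up to its top left entry then has the invariants of a shape operator
  with eigenvalues \<open>\<kappa>\<close>, \<open>\<kappa>\<close> and \<open>\<kappa> (1 - 1/m)\<close>.\<close>

lemma perturbed_form_invariants:
  fixes G h :: "real^3^3"
  assumes G: "det G \<noteq> 0" "det G = m\<^sup>2 * (G$2$2 * G$3$3 - G$2$3 * G$3$2)"
    and h: "\<And>i j. h$i$j = \<kappa> * (G$i$j - (if i = 1 \<and> j = 1 then m else 0))"
  shows "det h / det G = \<kappa> ^ 3 * (1 - inverse m)"
    and "trace (matrix_inv G ** h) = \<kappa> * (3 - inverse m)"
proof -
  define c where "c = G$2$2 * G$3$3 - G$2$3 * G$3$2"
  have m: "m \<noteq> 0" and c: "c \<noteq> 0" using G by (auto simp: c_def)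
  have "det h = \<kappa> ^ 3 * (det G - m * c)"
    by (simp add: det_3 h c_def) algebra
  then show "det h / det G = \<kappa> ^ 3 * (1 - inverse m)"
    using m c by (simp add: G(2) flip: c_def) (simp add: field_simps power2_eq_square)
  have inv: "matrix_inv G ** G = mat 1" "G ** matrix_inv G = mat 1"
    using G(1) someI_ex[of "\<lambda>B. G ** B = mat 1 \<and> B ** G = mat 1"]
    by (simp_all add: matrix_inv_def invertible_def flip: invertible_det_nz)
  have "G *v (matrix_inv G *v axis 1 1) = axis 1 1"
    by (simp add: matrix_vector_mul_assoc inv)
  then have col: "matrix_inv G *v axis 1 1 = (\<chi> k. det (\<chi> i j. if j = k then axis 1 1 $ i else G$i$j) / det G)"
    using cramer[OF G(1)] by blast
  have "(matrix_inv G *v axis 1 1) $ 1 = matrix_inv G $ 1 $ 1"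
    by (simp add: matrix_vector_mul_component inner_axis)
  then have "matrix_inv G $ 1 $ 1 = c / det G"
    unfolding col by (simp add: det_3 c_def axis_def)
  then have m11: "matrix_inv G $ 1 $ 1 * m = inverse m"
    using m c by (simp add: G(2) flip: c_def) (simp add: field_simps power2_eq_square)
  have diag: "(matrix_inv G ** h) $ i $ i = \<kappa> * ((matrix_inv G ** G) $ i $ i - (if i = 1 then inverse m else 0))" for i
    using exhaust_3[of i] by (auto simp: matrix_matrix_mult_def sum_3 h algebra_simps simp flip: m11)
  show "trace (matrix_inv G ** h) = \<kappa> * (3 - inverse m)"
    unfolding trace_def sum_3 diag inv by (simp add: mat_def algebra_simps)
qed

section \<open>Partial derivatives\<close>

lemma partial_eqI:
  assumes "(F has_derivative F') (at p)"
  shows "has_partial i F p" "partial i F p = F' (axis i 1)"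
proof -
  have "((\<lambda>h. F (p + h *\<^sub>R axis i 1)) has_derivative (\<lambda>h. F' (h *\<^sub>R axis i 1))) (at 0)"
    by (rule has_derivative_compose[where f="\<lambda>h. p + h *\<^sub>R axis i 1"])
      (use assms in \<open>auto intro!: derivative_eq_intros\<close>)
  moreover have "F' (h *\<^sub>R axis i 1) = h *\<^sub>R F' (axis i 1)" for h
    using has_derivative_linear[OF assms] by (simp add: linear_scale)
  ultimately have "((\<lambda>h. F (p + h *\<^sub>R axis i 1)) has_vector_derivative F' (axis i 1)) (at 0)"
    by (simp add: has_vector_derivative_def)
  then show "has_partial i F p" "partial i F p = F' (axis i 1)"
    by (auto simp: has_partial_def partial_def vector_derivative_at intro: differentiableI_vector)
qed

lemma smooth_on_partial:
  assumes "open S" "smooth_on S F"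
  shows "smooth_on S (partial i F)"
proof -
  have "Ck_on k S (partial i F)" for k
  proof (rule Ck_on_cong[OF assms(1)])
    have "Ck_on (Suc k) S F" using assms(2) by (simp only: smooth_on_def)
    moreover have "axis i 1 \<in> (Basis :: (real^3) set)" by (simp add: axis_in_Basis_iff)
    ultimately show "Ck_on k S (\<lambda>x. frechet_derivative F (at x) (axis i 1))" by simp
  qed (use partial_eqI(2)[OF smooth_on_has_derivative[OF assms(2)]] in auto)
  then show ?thesis by (simp add: smooth_on_def)
qed

lemma partial_lorentz:
  assumes "(X has_derivative X') (at p)" "(Y has_derivative Y') (at p)"
  shows "partial i (\<lambda>q. lorentz (X q) (Y q)) p =
    lorentz (partial i X p) (Y p) + lorentz (X p) (partial i Y p)"
  using partial_eqI(2)[OF lorentz.FDERIV[OF assms]] partial_eqI(2)[OF assms(1)] partial_eqI(2)[OF assms(2)]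
  by simp

lemma partial_lorentz_const:
  assumes "open S" "p \<in> S" "(X has_derivative X') (at p)" "(Y has_derivative Y') (at p)"
    and "\<And>q. q \<in> S \<Longrightarrow> lorentz (X q) (Y q) = c"
  shows "lorentz (partial i X p) (Y p) = - lorentz (X p) (partial i Y p)"
proof -
  have "((\<lambda>q. lorentz (X q) (Y q)) has_derivative (\<lambda>h. 0)) (at p)"
    by (rule has_derivative_transform_within_open[where f="\<lambda>q. c" and s=S])
      (use assms in auto)
  from partial_eqI(2)[OF this, of i] partial_lorentz[OF assms(3,4), of i] show ?thesis by simp
qed

section \<open>Tubes around unit speed curves\<close>

text \<open>A tube of constant radius around a unit speed curve, swept out by a normal field of constant
  causal character. The functions \<open>\<gamma>\<close> and \<open>e = \<gamma>'\<close> depend on the first parameter only.\<close>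

locale canal =
  fixes I :: "real set" and M :: "(real^3) set"
    and \<gamma> e :: "real \<Rightarrow> real^4" and V :: "real^3 \<Rightarrow> real^4" and \<rho> \<delta> :: real
  assumes open_I: "open I"
    and open_M: "open M" and M_I: "\<And>p. p \<in> M \<Longrightarrow> p$1 \<in> I"
    and smooth_curve: "smooth_on I \<gamma>" and smooth_tangent: "smooth_on I e"
    and velocity: "\<And>s. s \<in> I \<Longrightarrow> (\<gamma> has_vector_derivative e s) (at s)"
    and unit_speed: "\<And>s. s \<in> I \<Longrightarrow> lorentz (e s) (e s) = 1"
    and smooth_V: "smooth_on M V"
    and V_unit: "\<And>p. p \<in> M \<Longrightarrow> lorentz (V p) (V p) = \<delta>" and \<delta>: "\<delta> = 1 \<or> \<delta> = -1"
    and V_normal: "\<And>p. p \<in> M \<Longrightarrow> lorentz (V p) (e (p$1)) = 0"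
    and radius: "\<rho> \<noteq> 0"
begin

definition tube :: "real^3 \<Rightarrow> real^4" where
  "tube p = \<gamma> (p$1) + \<rho> *\<^sub>R V p"

text \<open>The factor by which the tube stretches the curve: \<open>1 + \<rho> \<langle>\<gamma>', V\<^sub>s\<rangle>\<close>. It is the function \<open>m\<close> of which
  both curvatures are affine functions of the reciprocal.\<close>

definition stretch :: "real^3 \<Rightarrow> real" where
  "stretch p = lorentz (e (p$1)) (partial 1 tube p)"

lemma smooth_tube: "smooth_on M tube"
proof -
  have "smooth_on M (\<lambda>p. \<gamma> (p$1))"
    by (rule smooth_on_compose_linear[OF bounded_linear_vec_nth open_I _ smooth_curve]) (auto simp: M_I)
  then show ?thesis
    using smooth_V unfolding smooth_on_def tube_def[abs_def]
    by (intro allI Ck_on_add Ck_on_bilinear[OF bounded_bilinear_scaleR] Ck_on_const open_M) auto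
qed

lemma curve_has_derivative:
  assumes "p \<in> M"
  shows "((\<lambda>q::real^3. \<gamma> (q$1)) has_derivative (\<lambda>h. h$1 *\<^sub>R e (p$1))) (at p)"
proof (rule has_derivative_compose[where f="\<lambda>q. q$1"])
  show "(\<gamma> has_derivative (\<lambda>h. h *\<^sub>R e (p$1))) (at (p$1))"
    using velocity[OF M_I[OF assms]] by (simp only: has_vector_derivative_def)
qed (rule bounded_linear_imp_has_derivative[OF bounded_linear_vec_nth])

lemma tangent_has_derivative:
  assumes "p \<in> M"
  shows "((\<lambda>q::real^3. e (q$1)) has_derivative (\<lambda>h. frechet_derivative e (at (p$1)) (h$1))) (at p)"
proof (rule has_derivative_compose[where f="\<lambda>q. q$1"])
  show "(e has_derivative frechet_derivative e (at (p$1))) (at (p$1))"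
    by (rule smooth_on_has_derivative[OF smooth_tangent M_I[OF assms]])
qed (rule bounded_linear_imp_has_derivative[OF bounded_linear_vec_nth])

lemma partial_tube:
  assumes "p \<in> M"
  shows "partial i tube p = (if i = 1 then e (p$1) else 0) + \<rho> *\<^sub>R partial i V p"
proof -
  have "(tube has_derivative (\<lambda>h. h$1 *\<^sub>R e (p$1) + \<rho> *\<^sub>R frechet_derivative V (at p) h)) (at p)"
    unfolding tube_def[abs_def]
    by (intro has_derivative_add curve_has_derivative[OF assms] has_derivative_scaleR_right
        smooth_on_has_derivative[OF smooth_V assms])
  from partial_eqI(2)[OF this] partial_eqI(2)[OF smooth_on_has_derivative[OF smooth_V assms]]
  show ?thesis by (simp add: axis_def)
qed

lemma V_normal_tube:
  assumes "p \<in> M"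
  shows "lorentz (V p) (partial i tube p) = 0"
proof -
  note dV = smooth_on_has_derivative[OF smooth_V assms]
  have "lorentz (V p) (partial i V p) = 0"
    using partial_lorentz_const[OF open_M assms dV dV V_unit, of i]
    by (simp add: lorentz_commute[of "partial i V p"])
  then show ?thesis
    by (simp add: partial_tube[OF assms] lorentz.add_right lorentz.scaleR_right lorentz.zero_right
        V_normal[OF assms])
qed

text \<open>As \<open>\<gamma>'\<close> is constant in \<open>t\<close> and \<open>w\<close>, differentiating \<open>\<langle>V, \<gamma>'\<rangle> = 0\<close> in these directions leaves
  \<open>\<langle>V\<^sub>t, \<gamma>'\<rangle> = \<langle>V\<^sub>w, \<gamma>'\<rangle> = 0\<close>.\<close>

lemma tangent_partial_tube:
  assumes "p \<in> M"
  shows "lorentz (e (p$1)) (partial i tube p) = (if i = 1 then stretch p else 0)"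
proof (cases "i = 1")
  case False
  have "partial i (\<lambda>q. e (q$1)) p = 0"
    using partial_eqI(2)[OF tangent_has_derivative[OF assms], of i] False
      linear_0[OF has_derivative_linear[OF smooth_on_has_derivative[OF smooth_tangent M_I[OF assms]]]]
    by (simp add: axis_def)
  then have "lorentz (partial i V p) (e (p$1)) = 0"
    using partial_lorentz_const[OF open_M assms smooth_on_has_derivative[OF smooth_V assms]
        tangent_has_derivative[OF assms] V_normal, of i]
    by (simp add: lorentz.zero_right)
  then show ?thesis
    using False by (simp add: partial_tube[OF assms] lorentz.add_right lorentz.scaleR_right lorentz.zero_right
        lorentz_commute[of "e _"])
qed (simp add: stretch_def)

text \<open>From \<open>\<langle>T\<^sub>i, V\<rangle> = 0\<close> follows \<open>\<langle>T\<^sub>i\<^sub>j, V\<rangle> = - \<langle>T\<^sub>i, V\<^sub>j\<rangle>\<close>, and \<open>V\<^sub>j\<close> is \<open>T\<^sub>j / \<rho>\<close>, corrected by \<open>\<gamma>' / \<rho>\<close> in the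
  direction of the curve. No second derivative of \<open>T\<close> has to be computed.\<close>

lemma second_form_V:
  assumes "p \<in> M"
  shows "lorentz (partial j (partial i tube) p) (V p) =
    - (1 / \<rho>) * (first_form tube p $ i $ j - (if i = 1 \<and> j = 1 then stretch p else 0))"
proof -
  have "lorentz (partial j (partial i tube) p) (V p) = - lorentz (partial i tube p) (partial j V p)"
    by (rule partial_lorentz_const[OF open_M assms
          smooth_on_has_derivative[OF smooth_on_partial[OF open_M smooth_tube] assms]
          smooth_on_has_derivative[OF smooth_V assms]])
      (simp add: V_normal_tube lorentz_commute[of _ "V _"])
  moreover have "partial j V p = (1 / \<rho>) *\<^sub>R (partial j tube p - (if j = 1 then e (p$1) else 0))"
    using radius by (simp add: partial_tube[OF assms])
  ultimately show ?thesis
    using tangent_partial_tube[OF assms, of i]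
    by (auto simp: first_form_def lorentz.diff_right lorentz.scaleR_right lorentz.zero_right
        lorentz_commute[of _ "e _"])
qed

lemma first_form_gram: "first_form tube p = gram (\<lambda>i. partial i tube p)"
  by (simp add: first_form_def gram_def)

lemma det_first_form:
  assumes "p \<in> M"
  shows "det (first_form tube p) = (stretch p)\<^sup>2 *
    (first_form tube p $2$2 * first_form tube p $3$3 - first_form tube p $2$3 * first_form tube p $3$2)"
  unfolding first_form_gram stretch_def
proof (rule det_gram_split[where V="V p"])
  show "lorentz (e (p$1)) (e (p$1)) = 1" using assms by (simp add: unit_speed M_I)
  show "lorentz (V p) (V p) \<noteq> 0" using \<delta> V_unit[OF assms] by auto
qed (use assms in \<open>simp_all add: V_normal V_normal_tube tangent_partial_tube\<close>)

lemma open_regular_points: "open (regular_points M tube)"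
proof -
  have "continuous_on M (\<lambda>p. lorentz (partial i tube p) (partial j tube p))" for i j
    by (intro lorentz.continuous_on smooth_on_imp_continuous_on smooth_on_partial open_M smooth_tube)
  then have "continuous_on M (\<lambda>p. det (first_form tube p))"
    by (simp add: det_3 first_form_def) (intro continuous_intros; assumption)
  then have "open (M \<inter> (\<lambda>p. det (first_form tube p)) -` (- {0}))"
    by (intro continuous_open_preimage open_M) auto
  moreover have "M \<inter> (\<lambda>p. det (first_form tube p)) -` (- {0}) = regular_points M tube"
    by (auto simp: regular_points_def)
  ultimately show ?thesis by simp
qed

text \<open>Here \<open>N = \<eta> V\<close> gives \<open>\<langle>N, N\<rangle> = \<eta>\<^sup>2 \<delta>\<close>. Both \<open>\<langle>N, N\<rangle>\<close> and \<open>\<delta>\<close> are \<open>1\<close> or \<open>-1\<close> and \<open>\<eta>\<^sup>2\<close> is not negative, so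
  \<open>\<eta>\<^sup>2 = 1\<close>.\<close>

lemma unit_normal_sign:
  assumes N: "unit_normal_on (regular_points M tube) tube N" and p: "p \<in> regular_points M tube"
  defines "\<eta> \<equiv> \<delta> * lorentz (N p) (V p)"
  shows "N p = \<eta> *\<^sub>R V p" "lorentz (N p) (N p) = \<delta>" "\<eta> = 1 \<or> \<eta> = -1"
proof -
  have M: "p \<in> M" and d: "det (gram (\<lambda>i. partial i tube p)) \<noteq> 0"
    using p by (auto simp: regular_points_def first_form_gram)
  have "N p = (lorentz (N p) (V p) / lorentz (V p) (V p)) *\<^sub>R V p"
    by (rule normal_unique[OF d]) (use N p M \<delta> in \<open>auto simp: unit_normal_on_def V_normal_tube V_unit\<close>)
  moreover have "lorentz (N p) (V p) / lorentz (V p) (V p) = \<eta>"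
    using \<delta> by (auto simp: \<eta>_def V_unit M)
  ultimately show NV: "N p = \<eta> *\<^sub>R V p" by simp
  have "lorentz (N p) (N p) = \<eta>\<^sup>2 * \<delta>"
    by (simp add: NV lorentz.scaleR_right lorentz.scaleR_left V_unit M power2_eq_square)
  moreover have "lorentz (N p) (N p) = 1 \<or> lorentz (N p) (N p) = -1"
    using N p by (auto simp: unit_normal_on_def)
  moreover have "\<eta>\<^sup>2 \<noteq> - 1" using zero_le_power2[of \<eta>] by linarith
  ultimately have "\<eta>\<^sup>2 = 1" using \<delta> by auto
  then show "\<eta> = 1 \<or> \<eta> = -1" by (simp add: power2_eq_1_iff)
  show "lorentz (N p) (N p) = \<delta>" using \<open>\<eta>\<^sup>2 = 1\<close> \<open>lorentz (N p) (N p) = \<eta>\<^sup>2 * \<delta>\<close> by simp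
qed

lemma curvatures:
  assumes N: "unit_normal_on (regular_points M tube) tube N" and p: "p \<in> regular_points M tube"
  defines "\<kappa> \<equiv> - (\<delta> * lorentz (N p) (V p)) / \<rho>"
  shows "gauss_curvature tube N p = \<delta> * \<kappa> ^ 3 * (1 - inverse (stretch p))"
    and "mean_curvature tube N p = \<kappa> * (3 - inverse (stretch p)) / (3 * \<delta>)"
proof -
  have M: "p \<in> M" and d: "det (first_form tube p) \<noteq> 0"
    using p by (auto simp: regular_points_def)
  have h: "second_form tube N p $ i $ j =
      \<kappa> * (first_form tube p $ i $ j - (if i = 1 \<and> j = 1 then stretch p else 0))" for i j
    unfolding second_form_def
    by (subst unit_normal_sign(1)[OF N p])
      (simp add: lorentz.scaleR_right second_form_V[OF M] \<kappa>_def del: times_divide_eq_left)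
  note inv = perturbed_form_invariants[OF d det_first_form[OF M] h]
  show "gauss_curvature tube N p = \<delta> * \<kappa> ^ 3 * (1 - inverse (stretch p))"
    unfolding gauss_curvature_def unit_normal_sign(2)[OF N p] times_divide_eq_right[symmetric] inv(1)
    by (rule mult.assoc[symmetric])
  show "mean_curvature tube N p = \<kappa> * (3 - inverse (stretch p)) / (3 * \<delta>)"
    using inv(2) by (simp add: mean_curvature_def shape_operator_def unit_normal_sign(2)[OF N p])
qed

text \<open>Near a regular point both curvatures are affine functions of \<open>1 / stretch\<close> with constant
  coefficients, so both derivatives are multiples of one linear form \<open>X\<close>.\<close>

lemma weingarten_on_regular_points:
  assumes N: "unit_normal_on (regular_points M tube) tube N"
  shows "weingarten_on x y (regular_points M tube) tube N"
  unfolding weingarten_on_def Let_def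
proof
  let ?U = "regular_points M tube"
  let ?\<eta> = "\<lambda>q. \<delta> * lorentz (N q) (V q)"
  fix p assume p: "p \<in> ?U"
  have M: "p \<in> M" and m: "stretch p \<noteq> 0"
    using p det_first_form by (auto simp: regular_points_def)
  note dT = smooth_on_has_derivative[OF smooth_on_partial[OF open_M smooth_tube] M]
  obtain m' where dm: "(stretch has_derivative m') (at p)"
    unfolding stretch_def[abs_def] using lorentz.FDERIV[OF tangent_has_derivative[OF M] dT] by blast
  define Y where "Y = (\<lambda>q. inverse (stretch q))"
  obtain X where X: "(Y has_derivative X) (at p)"
    unfolding Y_def using dm
      Deriv.has_derivative_inverse[of stretch p, OF m] by blast
  \<comment> \<open>The two possible signs are at distance \<open>2\<close>, so a continuous sign is locally constant.\<close>
  have "continuous_on ?U ?\<eta>"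
    using N smooth_on_imp_continuous_on[OF smooth_V]
    by (auto simp: unit_normal_on_def regular_points_def
        intro!: continuous_intros lorentz.continuous_on intro: continuous_on_subset)
  then have "isCont ?\<eta> p" using open_regular_points p continuous_on_eq_continuous_at by blast
  then have "\<forall>\<^sub>F q in nhds p. dist (?\<eta> q) (?\<eta> p) < 2"
    using tendstoD[of ?\<eta> "?\<eta> p" "nhds p" 2] tendsto_at_iff_tendsto_nhds[of ?\<eta> p]
    by (simp add: isCont_def)
  then have const: "\<forall>\<^sub>F q in nhds p. q \<in> ?U \<and> ?\<eta> q = ?\<eta> p"
    using eventually_nhds_in_open[OF open_regular_points p]
  proof eventually_elim
    case (elim q)
    then show ?case
      using unit_normal_sign(3)[OF N p] unit_normal_sign(3)[OF N, of q] \<delta> by (auto simp: dist_real_def)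
  qed
  define \<kappa> where "\<kappa> = - ?\<eta> p / \<rho>"
  have \<delta>0: "\<delta> \<noteq> 0" using \<delta> by auto
  have K: "(gauss_curvature tube N has_derivative (\<lambda>h. - (\<delta> * \<kappa> ^ 3) * X h)) (at p)"
  proof (rule has_derivative_transform_eventually)
    show "((\<lambda>q. \<delta> * \<kappa> ^ 3 * (1 - Y q)) has_derivative (\<lambda>h. - (\<delta> * \<kappa> ^ 3) * X h)) (at p)"
      by (auto intro!: derivative_eq_intros X)
    have "\<forall>\<^sub>F q in nhds p. \<delta> * \<kappa> ^ 3 * (1 - Y q) = gauss_curvature tube N q"
      using const by eventually_elim (auto simp: curvatures[OF N] \<kappa>_def Y_def \<delta>0)
    then show "\<forall>\<^sub>F q in at p. \<delta> * \<kappa> ^ 3 * (1 - Y q) = gauss_curvature tube N q"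
      by (simp add: eventually_at_filter eventually_mono)
  qed (use p in \<open>simp_all add: curvatures[OF N] \<kappa>_def Y_def\<close>)
  have H: "(mean_curvature tube N has_derivative (\<lambda>h. - (\<kappa> / (3 * \<delta>)) * X h)) (at p)"
  proof (rule has_derivative_transform_eventually)
    show "((\<lambda>q. \<kappa> * (3 - Y q) / (3 * \<delta>)) has_derivative (\<lambda>h. - (\<kappa> / (3 * \<delta>)) * X h)) (at p)"
      using \<delta> by (auto intro!: derivative_eq_intros X)
    have "\<forall>\<^sub>F q in nhds p. \<kappa> * (3 - Y q) / (3 * \<delta>) = mean_curvature tube N q"
      using const by eventually_elim (auto simp: curvatures[OF N] \<kappa>_def Y_def \<delta>0)
    then show "\<forall>\<^sub>F q in at p. \<kappa> * (3 - Y q) / (3 * \<delta>) = mean_curvature tube N q"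
      by (simp add: eventually_at_filter eventually_mono)
  qed (use p in \<open>simp_all add: curvatures[OF N] \<kappa>_def Y_def\<close>)
  show "has_partial x (mean_curvature tube N) p \<and> has_partial y (mean_curvature tube N) p \<and>
      has_partial x (gauss_curvature tube N) p \<and> has_partial y (gauss_curvature tube N) p \<and>
      partial x (mean_curvature tube N) p * partial y (gauss_curvature tube N) p -
      partial y (mean_curvature tube N) p * partial x (gauss_curvature tube N) p = 0"
    by (simp add: partial_eqI[OF H] partial_eqI[OF K])
qed

end

section \<open>The four tubular hypersurfaces\<close>

lemma open_parameter_domain:
  fixes I :: "real set" and D :: "(real \<times> real) set"
  assumes "open I" "open D"
  shows "open {p::real^3. p$1 \<in> I \<and> (p$2, p$3) \<in> D}"
proof -
  have "{p::real^3. p$1 \<in> I \<and> (p$2, p$3) \<in> D} = (\<lambda>p. p$1) -` I \<inter> (\<lambda>p. (p$2, p$3)) -` D" by auto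
  then show ?thesis
    using assms by (auto intro!: open_Int open_vimage continuous_intros)
qed

text \<open>In the pseudo-orthonormal frame the vector \<open>a F\<^sub>2 + b F\<^sub>3 + c F\<^sub>4\<close> has the square \<open>a\<^sup>2 + 2 b c\<close>, as \<open>F\<^sub>3\<close> and
  \<open>F\<^sub>4\<close> are null with product \<open>1\<close>. So this is the condition that turns the frame combination into a
  unit normal field along the tube.\<close>

lemma frame_tube_weingarten:
  fixes I :: "real set" and a b c :: "real^3 \<Rightarrow> real" and D :: "(real \<times> real) set"
  defines "M \<equiv> {p::real^3. p$1 \<in> I \<and> (p$2, p$3) \<in> D}"
  assumes curve: "partially_null_curve I \<gamma> F1 F2 F3 F4 k1 k2 k3" and D: "open D"
    and abc: "smooth_on M a" "smooth_on M b" "smooth_on M c"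
    and unit: "\<And>p. p \<in> M \<Longrightarrow> (a p)\<^sup>2 + 2 * b p * c p = \<delta>" and \<delta>: "\<delta> = 1 \<or> \<delta> = -1"
    and \<rho>: "\<rho> \<noteq> 0"
    and T: "T = (\<lambda>p. \<gamma> (p$1) + \<rho> *\<^sub>R (a p *\<^sub>R F2 (p$1) + b p *\<^sub>R F3 (p$1) + c p *\<^sub>R F4 (p$1)))"
    and N: "unit_normal_on (regular_points M T) T N"
  shows "weingarten_on x y (regular_points M T) T N"
proof -
  let ?V = "\<lambda>p. a p *\<^sub>R F2 (p$1) + b p *\<^sub>R F3 (p$1) + c p *\<^sub>R F4 (p$1)"
  have I: "open I" and smooth: "smooth_on I F2" "smooth_on I F3" "smooth_on I F4"
    using curve by (auto simp: partially_null_curve_def)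
  have M: "open M" unfolding M_def using I D by (rule open_parameter_domain)
  have frame: "smooth_on M (\<lambda>p. F (p$1))" if "smooth_on I F" for F :: "real \<Rightarrow> real^4"
    by (rule smooth_on_compose_linear[OF bounded_linear_vec_nth I _ that]) (auto simp: M_def)
  have "smooth_on M ?V"
    using abc smooth[THEN frame] M unfolding smooth_on_def
    by (intro allI Ck_on_add Ck_on_bilinear[OF bounded_bilinear_scaleR]) auto
  moreover have "lorentz (?V p) (?V p) = \<delta>" "lorentz (?V p) (F1 (p$1)) = 0" if "p \<in> M" for p
  proof -
    have "p$1 \<in> I" using that by (simp add: M_def)
    then have frame: "lorentz (F2 (p$1)) (F2 (p$1)) = 1" "lorentz (F3 (p$1)) (F4 (p$1)) = 1"
      "lorentz (F3 (p$1)) (F3 (p$1)) = 0" "lorentz (F4 (p$1)) (F4 (p$1)) = 0"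
      "lorentz (F1 (p$1)) (F2 (p$1)) = 0" "lorentz (F1 (p$1)) (F3 (p$1)) = 0"
      "lorentz (F1 (p$1)) (F4 (p$1)) = 0" "lorentz (F2 (p$1)) (F3 (p$1)) = 0"
      "lorentz (F2 (p$1)) (F4 (p$1)) = 0"
      using curve by (simp_all add: partially_null_curve_def)
    note frame = frame frame(2,5-9)[THEN trans[OF lorentz_commute]]
    show "lorentz (?V p) (?V p) = \<delta>" "lorentz (?V p) (F1 (p$1)) = 0"
      using unit[OF that]
      by (simp_all add: frame lorentz.add_left lorentz.add_right lorentz.scaleR_left
          lorentz.scaleR_right power2_eq_square)
  qed
  ultimately interpret canal I M \<gamma> F1 ?V \<rho> \<delta>
    using curve M \<delta> \<rho> by unfold_locales (auto simp: partially_null_curve_def M_def)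
  have "T = tube" by (simp add: T tube_def[abs_def])
  then show ?thesis using weingarten_on_regular_points N by simp
qed

theorem theorem11:
  fixes I :: "real set" and D :: "(real \<times> real) set"
    and \<gamma> F1 F2 F3 F4 :: "real \<Rightarrow> real^4" and k1 k2 k3 :: "real \<Rightarrow> real"
    and f g :: "real \<Rightarrow> real \<Rightarrow> real" and r \<sigma> :: real
  assumes "partially_null_curve I \<gamma> F1 F2 F3 F4 k1 k2 k3"
    and "open D"
    and "smooth_on D (\<lambda>(t, w). f t w)"
    and "smooth_on D (\<lambda>(t, w). g t w)"
    and "\<forall>(t, w)\<in>D. g t w \<noteq> 0"
    and "r > 0"
    and "\<sigma> = 1 \<or> \<sigma> = -1"
  shows "\<forall>T \<in> {tube1 \<sigma> r \<gamma> F2 F3 F4 f g, tube2 \<sigma> r \<gamma> F2 F3 F4 f g,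
               tube3 \<sigma> r \<gamma> F2 F3 F4 f g, tube4 \<sigma> r \<gamma> F2 F3 F4 f g}.
         \<forall>U N. U = regular_points {p. p$1 \<in> I \<and> (p$2, p$3) \<in> D} T \<and> unit_normal_on U T N \<longrightarrow>
           weingarten_on 1 2 U T N \<and> weingarten_on 1 3 U T N \<and> weingarten_on 2 3 U T N"
proof -
  define M where "M = {p::real^3. p$1 \<in> I \<and> (p$2, p$3) \<in> D}"
  let ?f = "\<lambda>p::real^3. f (p$2) (p$3)" and ?g = "\<lambda>p::real^3. g (p$2) (p$3)"
  have M: "open M"
    unfolding M_def using assms(1,2) by (auto simp: partially_null_curve_def intro!: open_parameter_domain)
  have L: "bounded_linear (\<lambda>p::real^3. (p$2, p$3))"
    by (intro bounded_linear_Pair bounded_linear_vec_nth)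
  have pull: "smooth_on M (\<lambda>p. h (p$2) (p$3))" if "smooth_on D (\<lambda>(t, w). h t w)"
    for h :: "real \<Rightarrow> real \<Rightarrow> real"
    using smooth_on_compose_linear[OF L assms(2) _ that, of M] by (auto simp: M_def)
  note sf = pull[OF assms(3)] and sg = pull[OF assms(4)]
  have g: "?g p \<noteq> 0" if "p \<in> M" for p using that assms(5) by (auto simp: M_def)
  have \<rho>: "\<sigma> * r \<noteq> 0" using assms(6,7) by auto
  note el = smooth_on_elementary[OF M sf]
  note smooth_coeffs = el el[THEN smooth_on_mult[OF M sg]]
    el[THEN smooth_on_half_quotient(1)[OF M _ sg g]] el[THEN smooth_on_half_quotient(2)[OF M _ sg g]]
  define W where "W T \<longleftrightarrow> (\<forall>N. unit_normal_on (regular_points M T) T N \<longrightarrow>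
    (\<forall>x y. weingarten_on x y (regular_points M T) T N))" for T
  have W: "W T" if "smooth_on M a" "smooth_on M b" "smooth_on M c"
    "\<And>p. p \<in> M \<Longrightarrow> (a p)\<^sup>2 + 2 * b p * c p = \<delta>" "\<delta> = 1 \<or> \<delta> = -1"
    "T = (\<lambda>p. \<gamma> (p$1) + (\<sigma> * r) *\<^sub>R (a p *\<^sub>R F2 (p$1) + b p *\<^sub>R F3 (p$1) + c p *\<^sub>R F4 (p$1)))"
    for T a b c \<delta>
    unfolding W_def
    by (intro allI impI frame_tube_weingarten[OF assms(1,2), folded M_def, OF that(1-5) \<rho> that(6)])
  have "W (tube1 \<sigma> r \<gamma> F2 F3 F4 f g)"
  proof (rule W[where a="\<lambda>p. sin (?f p)" and b="\<lambda>p. ?g p * cos (?f p)"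
        and c="\<lambda>p. cos (?f p) / (2 * ?g p)" and \<delta>="1"])
    show "(sin (?f p))\<^sup>2 + 2 * (?g p * cos (?f p)) * (cos (?f p) / (2 * ?g p)) = 1" if "p \<in> M" for p
      using g[OF that] by (simp flip: power2_eq_square)
  qed (simp_all add: smooth_coeffs tube1_def Let_def)
  moreover have "W (tube2 \<sigma> r \<gamma> F2 F3 F4 f g)"
  proof (rule W[where a="\<lambda>p. cos (?f p)" and b="\<lambda>p. ?g p * sin (?f p)"
        and c="\<lambda>p. sin (?f p) / (2 * ?g p)" and \<delta>="1"])
    show "(cos (?f p))\<^sup>2 + 2 * (?g p * sin (?f p)) * (sin (?f p) / (2 * ?g p)) = 1" if "p \<in> M" for p
      using g[OF that] by (simp flip: power2_eq_square)
  qed (simp_all add: smooth_coeffs tube2_def Let_def)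
  moreover have "W (tube3 \<sigma> r \<gamma> F2 F3 F4 f g)"
  proof (rule W[where a="\<lambda>p. cosh (?f p)" and b="\<lambda>p. ?g p * sinh (?f p)"
        and c="\<lambda>p. - (sinh (?f p) / (2 * ?g p))" and \<delta>="1"])
    show "(cosh (?f p))\<^sup>2 + 2 * (?g p * sinh (?f p)) * (- (sinh (?f p) / (2 * ?g p))) = 1" if "p \<in> M" for p
      using g[OF that] by (simp add: cosh_square_eq flip: power2_eq_square)
  qed (simp_all add: smooth_coeffs tube3_def Let_def)
  moreover have "W (tube4 \<sigma> r \<gamma> F2 F3 F4 f g)"
  proof (rule W[where a="\<lambda>p. sinh (?f p)" and b="\<lambda>p. ?g p * cosh (?f p)"
        and c="\<lambda>p. - (cosh (?f p) / (2 * ?g p))" and \<delta>="-1"])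
    show "(sinh (?f p))\<^sup>2 + 2 * (?g p * cosh (?f p)) * (- (cosh (?f p) / (2 * ?g p))) = -1" if "p \<in> M" for p
      using g[OF that] by (simp add: cosh_square_eq flip: power2_eq_square)
  qed (simp_all add: smooth_coeffs tube4_def Let_def)
  ultimately show ?thesis by (simp add: W_def flip: M_def)
qed

end
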